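(* Let $\mathbf V$ be a variety of loops and $\mathcal W$ a set of words that generates total inner mapping groups in $\mathbf V$. Then $$[A,B]_Q = \mathrm{Ng}\big(\{W_{\bar u}(a)/W_{\bar v}(a) : W\in\mathcal W,\ a\in A,\ \bar u/\bar v\in B\}\big)$$ for any normal subloops $A$, $B$ of any $Q\in\mathbf V$.
   Context: A loop is an algebra $(Q,1,\cdot,\backslash,/)$ satisfying $x\cdot 1=x=1\cdot x$, $x\backslash(x\cdot y)=y$, $x\cdot(x\backslash y)=y$, $(y\cdot x)/x=y$, $(y/x)\cdot x=y$. For $x\in Q$ define bijections of $Q$ by $L_x(y)=xy$, $R_x(y)=yx$, $M_x(y)=y\backslash x$. The total multiplication group is $\mathrm{TMlt}(Q)=\langle L_x,R_x,M_x : x\in Q\rangle$, and the total inner mapping group $\mathrm{TInn}(Q)$ is the stabilizer of $1$ in $\mathrm{TMlt}(Q)$. A word $W=W_{\bar x}$ in a finite tuple of variables $\bar x=x_1,\dots,x_n$ is an element of the free group on the letters $K_t$, where $K\in\{L,R,M\}$ and $t$ is a loop term over $\bar x$. For a loop $Q$ and a tuple $\bar a$ over $Q$, $W_{\bar a}\in\mathrm{TMlt}(Q)$ is the mapping obtained by replacing each letter $K_{t(\bar x)}^{\pm1}$ by the actual mapping $K_{t(\bar a)}^{\pm1}$ of $Q$. The word $W$ is inner for a variety $\mathbf V$ of loops if $W_{\bar a}\in\mathrm{TInn}(Q)$ for every $Q\in\mathbf V$ and every tuple $\bar a$ over $Q$. A set $\mathcal W$ of inner words for $\mathbf V$ generates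 total inner mapping groups in $\mathbf V$ if $\mathrm{TInn}(Q)=\langle W_{\bar a} : W\in\mathcal W,\ \bar a\text{ a tuple over }Q\rangle$ for every $Q\in\mathbf V$. A subloop $N$ of $Q$ is normal if $xN=Nx$, $x(yN)=(xy)N$, $N(xy)=(Nx)y$ for all $x,y\in Q$. For a normal subloop $N$ let $\gamma_N$ be the congruence $a\,\gamma_N\,b\iff a/b\in N$; for a congruence $\alpha$ let $N_\alpha=\{a\in Q : a\,\alpha\,1\}$, a normal subloop. For congruences $\alpha,\beta,\delta$ of an algebra, $C(\alpha,\beta;\delta)$ means that for every $(n+1)$-ary term operation $t$, every $a\,\alpha\,b$ and every $u_1\,\beta\,v_1,\dots,u_n\,\beta\,v_n$, $t(a,u_1,\dots,u_n)\,\delta\,t(a,v_1,\dots,v_n)$ implies $t(b,u_1,\dots,u_n)\,\delta\,t(b,v_1,\dots,v_n)$. The commutator $[\alpha,\beta]$ is the smallest congruence $\delta$ with $C(\alpha,\beta;\delta)$. For normal subloops $A,B$ of $Q$, $[A,B]_Q=N_{[\gamma_A,\gamma_B]}$. $\mathrm{Ng}(X)$ is the smallest normal subloop of $Q$ containing $X$. $\bar u/\bar v\in B$ means $u_i/v_i\in B$ for all $i$ (with $\bar u,\bar v$ tuples over $Q$). *)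

theory Defs
  imports "HOL-Algebra.Bij" "HOL-Algebra.Generated_Groups" "HOL-Library.Infinite_Typeclass"
begin

section \<open>Loops\<close>

record 'a loop = "'a monoid" +
  ldiv :: "'a \<Rightarrow> 'a \<Rightarrow> 'a"  (infixl \<open>\<setminus>\<index>\<close> 70)
  rdiv :: "'a \<Rightarrow> 'a \<Rightarrow> 'a"  (infixl \<open>\<oslash>\<index>\<close> 70)

locale loop =
  fixes Q :: "('a, 'm) loop_scheme" (structure)
  assumes one_closed: "\<one> \<in> carrier Q"
    and mult_closed: "\<lbrakk>x \<in> carrier Q; y \<in> carrier Q\<rbrakk> \<Longrightarrow> x \<otimes> y \<in> carrier Q"
    and ldiv_closed: "\<lbrakk>x \<in> carrier Q; y \<in> carrier Q\<rbrakk> \<Longrightarrow> x \<setminus> y \<in> carrier Q"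
    and rdiv_closed: "\<lbrakk>x \<in> carrier Q; y \<in> carrier Q\<rbrakk> \<Longrightarrow> x \<oslash> y \<in> carrier Q"
    and r_one: "x \<in> carrier Q \<Longrightarrow> x \<otimes> \<one> = x"
    and l_one: "x \<in> carrier Q \<Longrightarrow> \<one> \<otimes> x = x"
    and ldiv_mult: "\<lbrakk>x \<in> carrier Q; y \<in> carrier Q\<rbrakk> \<Longrightarrow> x \<setminus> (x \<otimes> y) = y"
    and mult_ldiv: "\<lbrakk>x \<in> carrier Q; y \<in> carrier Q\<rbrakk> \<Longrightarrow> x \<otimes> (x \<setminus> y) = y"
    and mult_rdiv: "\<lbrakk>x \<in> carrier Q; y \<in> carrier Q\<rbrakk> \<Longrightarrow> (y \<otimes> x) \<oslash> x = y"
    and rdiv_mult: "\<lbrakk>x \<in> carrier Q; y \<in> carrier Q\<rbrakk> \<Longrightarrow> (y \<oslash> x) \<otimes> x = y"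


section \<open>Terms and varieties\<close>

text \<open>
  A term involves only finitely many variables, so a finite tuple over \<open>Q\<close> is represented
  throughout by a valuation \<open>nat \<Rightarrow> 'a\<close> with values in the carrier, of which only the entries
  for the variables that actually occur matter.
\<close>

datatype lterm = Var nat | One | Mul lterm lterm | LDiv lterm lterm | RDiv lterm lterm

primrec eval :: "('a, 'm) loop_scheme \<Rightarrow> (nat \<Rightarrow> 'a) \<Rightarrow> lterm \<Rightarrow> 'a" where
  "eval Q \<rho> (Var i) = \<rho> i"
| "eval Q \<rho> One = \<one>\<^bsub>Q\<^esub>"
| "eval Q \<rho> (Mul s t) = eval Q \<rho> s \<otimes>\<^bsub>Q\<^esub> eval Q \<rho> t"
| "eval Q \<rho> (LDiv s t) = eval Q \<rho> s \<setminus>\<^bsub>Q\<^esub> eval Q \<rho> t"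
| "eval Q \<rho> (RDiv s t) = eval Q \<rho> s \<oslash>\<^bsub>Q\<^esub> eval Q \<rho> t"

definition tuples :: "('a, 'm) loop_scheme \<Rightarrow> (nat \<Rightarrow> 'a) set" where
  "tuples Q = (UNIV \<rightarrow> carrier Q)"

definition satisfies :: "('a, 'm) loop_scheme \<Rightarrow> (lterm \<times> lterm) set \<Rightarrow> bool" where
  "satisfies Q E \<longleftrightarrow> (\<forall>(s, t) \<in> E. \<forall>\<rho> \<in> tuples Q. eval Q \<rho> s = eval Q \<rho> t)"

text \<open>
  A variety is an equational class. HOL cannot collect loops over different types into one class,
  so it consists of all the loops satisfying the identities whose carrier is a subset (of any size)
  of the type \<open>'a\<close>, which serves as the universe. When \<open>'a\<close> is infinite, every finite or
  countable loop has an isomorphic copy among them, in particular the free loops of finite rank.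
\<close>

definition loop_variety :: "'a loop set \<Rightarrow> bool" where
  "loop_variety V \<longleftrightarrow> (\<exists>E. V = {Q. loop Q \<and> satisfies Q E})"


section \<open>Total multiplication groups and inner words\<close>

definition Lmap :: "('a, 'm) loop_scheme \<Rightarrow> 'a \<Rightarrow> 'a \<Rightarrow> 'a" where
  "Lmap Q x = (\<lambda>y \<in> carrier Q. x \<otimes>\<^bsub>Q\<^esub> y)"

definition Rmap :: "('a, 'm) loop_scheme \<Rightarrow> 'a \<Rightarrow> 'a \<Rightarrow> 'a" where
  "Rmap Q x = (\<lambda>y \<in> carrier Q. y \<otimes>\<^bsub>Q\<^esub> x)"

definition Mmap :: "('a, 'm) loop_scheme \<Rightarrow> 'a \<Rightarrow> 'a \<Rightarrow> 'a" where
  "Mmap Q x = (\<lambda>y \<in> carrier Q. y \<setminus>\<^bsub>Q\<^esub> x)"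

definition TMlt :: "('a, 'm) loop_scheme \<Rightarrow> ('a \<Rightarrow> 'a) set" where
  "TMlt Q = generate (BijGroup (carrier Q))
     (Lmap Q ` carrier Q \<union> Rmap Q ` carrier Q \<union> Mmap Q ` carrier Q)"

definition TInn :: "('a, 'm) loop_scheme \<Rightarrow> ('a \<Rightarrow> 'a) set" where
  "TInn Q = {f \<in> TMlt Q. f \<one>\<^bsub>Q\<^esub> = \<one>\<^bsub>Q\<^esub>}"

text \<open>
  The elements of the free group on \<open>'k\<close> are represented by their normal forms, the reduced words.
  A letter \<open>(True, k)\<close> stands for \<open>k\<close> and \<open>(False, k)\<close> for its inverse.
\<close>

definition reduced :: "(bool \<times> 'k) list \<Rightarrow> bool" where
  "reduced = successively (\<lambda>(e, k) (e', k'). \<not> (k = k' \<and> e \<noteq> e'))"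

typedef 'k free_group = "{w :: (bool \<times> 'k) list. reduced w}"
  morphisms letters Abs_free_group
  by (rule exI[of _ "[]"]) (simp add: reduced_def)

datatype letter = L lterm | R lterm | M lterm

type_synonym loop_word = "letter free_group"

primrec letter_map :: "('a, 'm) loop_scheme \<Rightarrow> (nat \<Rightarrow> 'a) \<Rightarrow> letter \<Rightarrow> 'a \<Rightarrow> 'a" where
  "letter_map Q \<rho> (L t) = Lmap Q (eval Q \<rho> t)"
| "letter_map Q \<rho> (R t) = Rmap Q (eval Q \<rho> t)"
| "letter_map Q \<rho> (M t) = Mmap Q (eval Q \<rho> t)"

definition signed_letter_map ::
  "('a, 'm) loop_scheme \<Rightarrow> (nat \<Rightarrow> 'a) \<Rightarrow> bool \<times> letter \<Rightarrow> 'a \<Rightarrow> 'a" where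
  "signed_letter_map Q \<rho> = (\<lambda>(e, k).
     if e then letter_map Q \<rho> k else inv\<^bsub>BijGroup (carrier Q)\<^esub> (letter_map Q \<rho> k))"

definition word_map :: "('a, 'm) loop_scheme \<Rightarrow> loop_word \<Rightarrow> (nat \<Rightarrow> 'a) \<Rightarrow> 'a \<Rightarrow> 'a" where
  "word_map Q W \<rho> =
     foldr (\<lambda>l f. signed_letter_map Q \<rho> l \<otimes>\<^bsub>BijGroup (carrier Q)\<^esub> f)
       (letters W) \<one>\<^bsub>BijGroup (carrier Q)\<^esub>"

definition inner_word :: "'a loop set \<Rightarrow> loop_word \<Rightarrow> bool" where
  "inner_word V W \<longleftrightarrow> (\<forall>Q \<in> V. \<forall>\<rho> \<in> tuples Q. word_map Q W \<rho> \<in> TInn Q)"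

definition generates_TInn :: "'a loop set \<Rightarrow> loop_word set \<Rightarrow> bool" where
  "generates_TInn V \<W> \<longleftrightarrow>
     (\<forall>W \<in> \<W>. inner_word V W) \<and>
     (\<forall>Q \<in> V. TInn Q =
        generate (BijGroup (carrier Q)) {word_map Q W \<rho> | W \<rho>. W \<in> \<W> \<and> \<rho> \<in> tuples Q})"


section \<open>Normal subloops, congruences and the commutator\<close>

definition subloop :: "'a set \<Rightarrow> ('a, 'm) loop_scheme \<Rightarrow> bool" where
  "subloop N Q \<longleftrightarrow> N \<subseteq> carrier Q \<and> \<one>\<^bsub>Q\<^esub> \<in> N \<and>
     (\<forall>x \<in> N. \<forall>y \<in> N. x \<otimes>\<^bsub>Q\<^esub> y \<in> N \<and> x \<setminus>\<^bsub>Q\<^esub> y \<in> N \<and> x \<oslash>\<^bsub>Q\<^esub> y \<in> N)"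

definition normal_subloop :: "'a set \<Rightarrow> ('a, 'm) loop_scheme \<Rightarrow> bool" where
  "normal_subloop N Q \<longleftrightarrow> subloop N Q \<and>
     (\<forall>x \<in> carrier Q. \<forall>y \<in> carrier Q.
        x <#\<^bsub>Q\<^esub> N = N #>\<^bsub>Q\<^esub> x \<and>
        x <#\<^bsub>Q\<^esub> (y <#\<^bsub>Q\<^esub> N) = (x \<otimes>\<^bsub>Q\<^esub> y) <#\<^bsub>Q\<^esub> N \<and>
        N #>\<^bsub>Q\<^esub> (x \<otimes>\<^bsub>Q\<^esub> y) = (N #>\<^bsub>Q\<^esub> x) #>\<^bsub>Q\<^esub> y)"

definition Ng :: "('a, 'm) loop_scheme \<Rightarrow> 'a set \<Rightarrow> 'a set" where
  "Ng Q X = (LEAST N. normal_subloop N Q \<and> X \<subseteq> N)"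

definition congruence :: "('a, 'm) loop_scheme \<Rightarrow> ('a \<times> 'a) set \<Rightarrow> bool" where
  "congruence Q \<alpha> \<longleftrightarrow> equiv (carrier Q) \<alpha> \<and>
     (\<forall>(a, b) \<in> \<alpha>. \<forall>(c, d) \<in> \<alpha>.
        (a \<otimes>\<^bsub>Q\<^esub> c, b \<otimes>\<^bsub>Q\<^esub> d) \<in> \<alpha> \<and>
        (a \<setminus>\<^bsub>Q\<^esub> c, b \<setminus>\<^bsub>Q\<^esub> d) \<in> \<alpha> \<and>
        (a \<oslash>\<^bsub>Q\<^esub> c, b \<oslash>\<^bsub>Q\<^esub> d) \<in> \<alpha>)"

definition cong_of :: "('a, 'm) loop_scheme \<Rightarrow> 'a set \<Rightarrow> ('a \<times> 'a) set" where
  "cong_of Q N = {(a, b). a \<in> carrier Q \<and> b \<in> carrier Q \<and> a \<oslash>\<^bsub>Q\<^esub> b \<in> N}"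

definition kernel_of :: "('a, 'm) loop_scheme \<Rightarrow> ('a \<times> 'a) set \<Rightarrow> 'a set" where
  "kernel_of Q \<alpha> = {a \<in> carrier Q. (a, \<one>\<^bsub>Q\<^esub>) \<in> \<alpha>}"

text \<open>
  In \<open>t(x, u\<^sub>1, \<dots>, u\<^sub>n)\<close> the variable \<open>0\<close> plays the role of \<open>x\<close> and the variable \<open>Suc i\<close>
  that of the \<open>i\<close>-th parameter. The arity \<open>n\<close> is implicit, as any term uses finitely many variables.
\<close>

definition centralizes ::
  "('a, 'm) loop_scheme \<Rightarrow> ('a \<times> 'a) set \<Rightarrow> ('a \<times> 'a) set \<Rightarrow> ('a \<times> 'a) set \<Rightarrow> bool" where
  "centralizes Q \<alpha> \<beta> \<delta> \<longleftrightarrow>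
     (\<forall>t a b u v. (a, b) \<in> \<alpha> \<longrightarrow> (\<forall>i. (u i, v i) \<in> \<beta>) \<longrightarrow>
        (eval Q (case_nat a u) t, eval Q (case_nat a v) t) \<in> \<delta> \<longrightarrow>
        (eval Q (case_nat b u) t, eval Q (case_nat b v) t) \<in> \<delta>)"

definition cong_commutator ::
  "('a, 'm) loop_scheme \<Rightarrow> ('a \<times> 'a) set \<Rightarrow> ('a \<times> 'a) set \<Rightarrow> ('a \<times> 'a) set" where
  "cong_commutator Q \<alpha> \<beta> = (LEAST \<delta>. congruence Q \<delta> \<and> centralizes Q \<alpha> \<beta> \<delta>)"

definition commutator :: "('a, 'm) loop_scheme \<Rightarrow> 'a set \<Rightarrow> 'a set \<Rightarrow> 'a set" where
  "commutator Q A B = kernel_of Q (cong_commutator Q (cong_of Q A) (cong_of Q B))"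

end

theory Submission
  imports Defs
begin

text \<open>
  Regard \<open>\<gamma>\<^sub>B\<close> as a subloop \<open>P\<close> of \<open>Q \<times> Q\<close> and let \<open>D\<close> be the right-hand side. Since \<open>P\<close> lies in the
  variety, \<open>TInn P\<close> is generated by the maps \<open>(x, y) \<mapsto> (W\<^sub>u x, W\<^sub>v y)\<close> with \<open>(u, v)\<close> a tuple over \<open>P\<close>.
  By the choice of \<open>D\<close> these preserve \<open>S = {(x, y) \<in> P. x \<in> A, x \<gamma>\<^sub>D y}\<close>, so \<open>S\<close> is normal in \<open>P\<close>. Its
  congruence relates \<open>(a, a)\<close> to \<open>(b, b)\<close> whenever \<open>a \<gamma>\<^sub>A b\<close>, and applying a term to such pairs gives
  \<open>C(\<gamma>\<^sub>A, \<gamma>\<^sub>B; \<gamma>\<^sub>D)\<close>. Conversely, \<open>W\<^sub>u(x)\<close> is a term operation in \<open>x, u\<close> with \<open>W\<^sub>u(1) = 1 = W\<^sub>v(1)\<close>,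
  so the term condition puts each \<open>W\<^sub>u(a) / W\<^sub>v(a)\<close> into the kernel of every centralizing congruence.
\<close>

section \<open>Translations and words\<close>

context loop
begin

lemmas closed = one_closed mult_closed ldiv_closed rdiv_closed
lemmas cancel = ldiv_mult mult_ldiv mult_rdiv rdiv_mult

text \<open>Together with the next identity this makes \<open>y \<setminus> x\<close> and
  \<open>x \<oslash> y\<close> mutually inverse as functions of \<open>y\<close>, which is what
  bijectivity of \<open>Mmap Q x\<close> rests on.\<close>

lemma ldiv_rdiv: "\<lbrakk>x \<in> carrier Q; y \<in> carrier Q\<rbrakk> \<Longrightarrow> (x \<oslash> y) \<setminus> x = y"
  by (metis ldiv_mult rdiv_mult rdiv_closed)

lemma rdiv_ldiv: "\<lbrakk>x \<in> carrier Q; y \<in> carrier Q\<rbrakk> \<Longrightarrow> x \<oslash> (y \<setminus> x) = y"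
  by (metis mult_rdiv mult_ldiv ldiv_closed)

lemma rdiv_self: "x \<in> carrier Q \<Longrightarrow> x \<oslash> x = \<one>"
  by (metis l_one mult_rdiv one_closed)

lemma ldiv_self: "x \<in> carrier Q \<Longrightarrow> x \<setminus> x = \<one>"
  by (metis r_one ldiv_mult one_closed)

lemma rdiv_one: "x \<in> carrier Q \<Longrightarrow> x \<oslash> \<one> = x"
  by (metis r_one mult_rdiv one_closed)

lemma eval_closed: "\<rho> \<in> tuples Q \<Longrightarrow> eval Q \<rho> t \<in> carrier Q"
  by (induction t) (auto simp: tuples_def closed)

lemma case_nat_tuples: "\<lbrakk>x \<in> carrier Q; \<rho> \<in> tuples Q\<rbrakk> \<Longrightarrow> case_nat x \<rho> \<in> tuples Q"
  by (auto simp: tuples_def Pi_iff split: nat.split)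

end

section \<open>Bijections of a set and their inverses\<close>

lemma restrict_Bij:
  assumes "f \<in> S \<rightarrow> S" "g \<in> S \<rightarrow> S" "\<And>x. x \<in> S \<Longrightarrow> g (f x) = x" "\<And>x. x \<in> S \<Longrightarrow> f (g x) = x"
  shows "restrict f S \<in> Bij S"
proof -
  have "bij_betw f S S"
    by (rule bij_betw_byWitness[of S g]) (use assms in auto)
  then show ?thesis
    by (simp add: Bij_def bij_betw_restrict_eq)
qed

text \<open>Elements of \<open>BijGroup S\<close> are undefined off \<open>S\<close>, hence the
  \<open>restrict\<close>. The rule turns every inverse letter into an explicit division, so that
  negative letters are expressible by terms.\<close>

lemma inv_BijGroup_restrict:
  assumes "f \<in> S \<rightarrow> S" "g \<in> S \<rightarrow> S" "\<And>x. x \<in> S \<Longrightarrow> g (f x) = x" "\<And>x. x \<in> S \<Longrightarrow> f (g x) = x"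
  shows "inv\<^bsub>BijGroup S\<^esub> (restrict f S) = restrict g S"
proof (rule group.inv_equality[OF group_BijGroup])
  have "restrict f S \<in> Bij S" "restrict g S \<in> Bij S"
    using restrict_Bij[of f S g] restrict_Bij[of g S f] assms by auto
  then show "restrict f S \<in> carrier (BijGroup S)" "restrict g S \<in> carrier (BijGroup S)"
    and "restrict g S \<otimes>\<^bsub>BijGroup S\<^esub> restrict f S = \<one>\<^bsub>BijGroup S\<^esub>"
    using assms by (auto simp: BijGroup_def compose_def fun_eq_iff)
qed

lemma BijGroup_mult_apply:
  "\<lbrakk>f \<in> Bij S; g \<in> Bij S; x \<in> S\<rbrakk> \<Longrightarrow> (f \<otimes>\<^bsub>BijGroup S\<^esub> g) x = f (g x)"
  by (simp add: BijGroup_def compose_def)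

lemma BijGroup_mult_Bij: "\<lbrakk>f \<in> Bij S; g \<in> Bij S\<rbrakk> \<Longrightarrow> f \<otimes>\<^bsub>BijGroup S\<^esub> g \<in> Bij S"
  by (simp add: BijGroup_def compose_Bij)

lemma carrier_BijGroup: "carrier (BijGroup S) = Bij S"
  by (simp add: BijGroup_def)

context loop
begin

lemma translations_Bij:
  assumes "x \<in> carrier Q"
  shows "Lmap Q x \<in> Bij (carrier Q)" "Rmap Q x \<in> Bij (carrier Q)" "Mmap Q x \<in> Bij (carrier Q)"
  unfolding Lmap_def Rmap_def Mmap_def
  using assms restrict_Bij[of "\<lambda>y. x \<otimes> y" "carrier Q" "\<lambda>y. x \<setminus> y"]
    restrict_Bij[of "\<lambda>y. y \<otimes> x" "carrier Q" "\<lambda>y. y \<oslash> x"]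
    restrict_Bij[of "\<lambda>y. y \<setminus> x" "carrier Q" "\<lambda>y. x \<oslash> y"]
  by (auto simp: closed cancel ldiv_rdiv rdiv_ldiv)

lemma inv_translations:
  assumes "x \<in> carrier Q"
  shows "inv\<^bsub>BijGroup (carrier Q)\<^esub> (Lmap Q x) = (\<lambda>y \<in> carrier Q. x \<setminus> y)"
    and "inv\<^bsub>BijGroup (carrier Q)\<^esub> (Rmap Q x) = (\<lambda>y \<in> carrier Q. y \<oslash> x)"
    and "inv\<^bsub>BijGroup (carrier Q)\<^esub> (Mmap Q x) = (\<lambda>y \<in> carrier Q. x \<oslash> y)"
  unfolding Lmap_def Rmap_def Mmap_def
  using assms by (auto intro!: inv_BijGroup_restrict simp: closed cancel ldiv_rdiv rdiv_ldiv)

end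

section \<open>Words as loop terms\<close>

primrec lift_vars :: "lterm \<Rightarrow> lterm" where
  "lift_vars (Var i) = Var (Suc i)"
| "lift_vars One = One"
| "lift_vars (Mul s t) = Mul (lift_vars s) (lift_vars t)"
| "lift_vars (LDiv s t) = LDiv (lift_vars s) (lift_vars t)"
| "lift_vars (RDiv s t) = RDiv (lift_vars s) (lift_vars t)"

lemma eval_lift_vars: "eval Q (case_nat x \<rho>) (lift_vars t) = eval Q \<rho> t"
  by (induction t) auto

text \<open>Inverse letters become divisions. For \<open>M\<close> the inverse is a right division
  with \<open>s\<close> as divisor: y \<setminus> x = z means yz = x, that is, y = x \<oslash>
  z.\<close>

fun letter_term :: "bool \<times> letter \<Rightarrow> lterm \<Rightarrow> lterm" where
  "letter_term (True, L t) s = Mul (lift_vars t) s"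
| "letter_term (False, L t) s = LDiv (lift_vars t) s"
| "letter_term (True, R t) s = Mul s (lift_vars t)"
| "letter_term (False, R t) s = RDiv s (lift_vars t)"
| "letter_term (True, M t) s = LDiv s (lift_vars t)"
| "letter_term (False, M t) s = RDiv (lift_vars t) s"

text \<open>Plain letter lists admit list induction, whereas \<open>loop_word\<close> is an abstract
  type; \<open>word_map\<close> is the instance \<open>letters W\<close>.\<close>

definition letters_map ::
  "('a, 'm) loop_scheme \<Rightarrow> (nat \<Rightarrow> 'a) \<Rightarrow> (bool \<times> letter) list \<Rightarrow> 'a \<Rightarrow> 'a" where
  "letters_map Q \<rho> w =
     foldr (\<lambda>l f. signed_letter_map Q \<rho> l \<otimes>\<^bsub>BijGroup (carrier Q)\<^esub> f) w \<one>\<^bsub>BijGroup (carrier Q)\<^esub>"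

lemma letters_map_Cons:
  "letters_map Q \<rho> (l # w) = signed_letter_map Q \<rho> l \<otimes>\<^bsub>BijGroup (carrier Q)\<^esub> letters_map Q \<rho> w"
  by (simp add: letters_map_def)

lemma letters_map_Nil: "x \<in> carrier Q \<Longrightarrow> letters_map Q \<rho> [] x = x"
  by (simp add: letters_map_def BijGroup_def)

lemma word_map_letters: "word_map Q W \<rho> = letters_map Q \<rho> (letters W)"
  by (simp add: word_map_def letters_map_def)

text \<open>The image of variable \<open>0\<close> under the word, whose own variables are shifted by one.\<close>

definition word_term :: "loop_word \<Rightarrow> lterm" where
  "word_term W = foldr letter_term (letters W) (Var 0)"

context loop
begin

lemma signed_letter_map_Bij:
  assumes "\<rho> \<in> tuples Q"
  shows "signed_letter_map Q \<rho> l \<in> Bij (carrier Q)"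
proof -
  obtain e k where l: "l = (e, k)" by fastforce
  have "letter_map Q \<rho> k \<in> Bij (carrier Q)"
    using eval_closed[OF assms] by (cases k) (auto simp: translations_Bij)
  then show ?thesis
    using group.inv_closed[OF group_BijGroup, of "letter_map Q \<rho> k"]
    by (auto simp: l signed_letter_map_def carrier_BijGroup)
qed

lemma signed_letter_map_simps:
  assumes "\<rho> \<in> tuples Q"
  shows "signed_letter_map Q \<rho> (True, L t) = (\<lambda>y \<in> carrier Q. eval Q \<rho> t \<otimes> y)"
    and "signed_letter_map Q \<rho> (False, L t) = (\<lambda>y \<in> carrier Q. eval Q \<rho> t \<setminus> y)"
    and "signed_letter_map Q \<rho> (True, R t) = (\<lambda>y \<in> carrier Q. y \<otimes> eval Q \<rho> t)"
    and "signed_letter_map Q \<rho> (False, R t) = (\<lambda>y \<in> carrier Q. y \<oslash> eval Q \<rho> t)"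
    and "signed_letter_map Q \<rho> (True, M t) = (\<lambda>y \<in> carrier Q. y \<setminus> eval Q \<rho> t)"
    and "signed_letter_map Q \<rho> (False, M t) = (\<lambda>y \<in> carrier Q. eval Q \<rho> t \<oslash> y)"
  using inv_translations[OF eval_closed[OF assms, of t]]
  by (simp_all add: signed_letter_map_def) (simp_all add: Lmap_def Rmap_def Mmap_def)

lemma signed_letter_map_eval:
  assumes "\<rho> \<in> tuples Q" "eval Q (case_nat x \<rho>) s \<in> carrier Q"
  shows "signed_letter_map Q \<rho> l (eval Q (case_nat x \<rho>) s) =
    eval Q (case_nat x \<rho>) (letter_term l s)"
  using assms(2)
  by (cases "(l, s)" rule: letter_term.cases)
    (simp_all add: signed_letter_map_simps[OF assms(1)] eval_lift_vars)

lemma letters_map_Bij: "\<rho> \<in> tuples Q \<Longrightarrow> letters_map Q \<rho> w \<in> Bij (carrier Q)"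
proof (induction w)
  case Nil
  have "\<one>\<^bsub>BijGroup (carrier Q)\<^esub> \<in> carrier (BijGroup (carrier Q))"
    by (rule monoid.one_closed[OF group.is_monoid[OF group_BijGroup]])
  then show ?case
    by (simp add: letters_map_def carrier_BijGroup)
qed (simp add: letters_map_Cons BijGroup_mult_Bij signed_letter_map_Bij)

lemma letters_map_step:
  "\<lbrakk>\<rho> \<in> tuples Q; x \<in> carrier Q\<rbrakk> \<Longrightarrow>
    letters_map Q \<rho> (l # w) x = signed_letter_map Q \<rho> l (letters_map Q \<rho> w x)"
  by (simp add: letters_map_Cons BijGroup_mult_apply signed_letter_map_Bij letters_map_Bij)

text \<open>Each letter wraps one more operation around the term obtained from the rest of the
  list.\<close>

lemma letters_map_eval:
  assumes "\<rho> \<in> tuples Q" "x \<in> carrier Q"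
  shows "letters_map Q \<rho> w x = eval Q (case_nat x \<rho>) (foldr letter_term w (Var 0))"
proof (induction w)
  case Nil
  show ?case using assms by (simp add: letters_map_Nil)
next
  case (Cons l w)
  then show ?case
    using eval_closed[OF case_nat_tuples[OF assms(2,1)]]
    by (simp add: letters_map_step assms signed_letter_map_eval)
qed

lemma word_map_Bij: "\<rho> \<in> tuples Q \<Longrightarrow> word_map Q W \<rho> \<in> Bij (carrier Q)"
  by (simp add: word_map_letters letters_map_Bij)

lemma word_map_closed: "\<lbrakk>\<rho> \<in> tuples Q; x \<in> carrier Q\<rbrakk> \<Longrightarrow> word_map Q W \<rho> x \<in> carrier Q"
  using Bij_imp_funcset[OF word_map_Bij] by blast

text \<open>The bridge between words and the commutator: the argument sits in variable 0, the one
  that moves from a to b in the term condition.\<close>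

lemma word_map_eval:
  "\<lbrakk>\<rho> \<in> tuples Q; x \<in> carrier Q\<rbrakk> \<Longrightarrow> word_map Q W \<rho> x = eval Q (case_nat x \<rho>) (word_term W)"
  by (simp add: word_map_letters word_term_def letters_map_eval)

lemma signed_letter_map_cancel:
  assumes "\<rho> \<in> tuples Q" "x \<in> carrier Q"
  shows "signed_letter_map Q \<rho> (\<not> e, k) (signed_letter_map Q \<rho> (e, k) x) = x"
  using assms(2) eval_closed[OF assms(1)]
  by (cases k; cases e)
    (simp_all add: signed_letter_map_simps[OF assms(1)] closed cancel ldiv_rdiv rdiv_ldiv)

end

section \<open>Homomorphisms, terms and words\<close>

definition loop_hom :: "('a, 'm) loop_scheme \<Rightarrow> ('b, 'n) loop_scheme \<Rightarrow> ('a \<Rightarrow> 'b) \<Rightarrow> bool" where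
  "loop_hom P Q h \<longleftrightarrow> h \<in> carrier P \<rightarrow> carrier Q \<and> h \<one>\<^bsub>P\<^esub> = \<one>\<^bsub>Q\<^esub> \<and>
     (\<forall>x \<in> carrier P. \<forall>y \<in> carrier P. h (x \<otimes>\<^bsub>P\<^esub> y) = h x \<otimes>\<^bsub>Q\<^esub> h y \<and>
        h (x \<setminus>\<^bsub>P\<^esub> y) = h x \<setminus>\<^bsub>Q\<^esub> h y \<and> h (x \<oslash>\<^bsub>P\<^esub> y) = h x \<oslash>\<^bsub>Q\<^esub> h y)"

lemma loop_hom_eval:
  assumes "loop P" "loop_hom P Q h" "\<rho> \<in> tuples P"
  shows "h (eval P \<rho> t) = eval Q (h \<circ> \<rho>) t"
  using assms loop.eval_closed[OF assms(1,3)]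
  by (induction t) (auto simp: loop_hom_def)

lemma loop_hom_tuples: "loop_hom P Q h \<Longrightarrow> \<rho> \<in> tuples P \<Longrightarrow> h \<circ> \<rho> \<in> tuples Q"
  by (auto simp: loop_hom_def tuples_def)

text \<open>Applying a word is evaluating \<open>word_term W\<close>, and homomorphisms commute with
  evaluation.\<close>

lemma loop_hom_word_map:
  assumes "loop P" "loop Q" "loop_hom P Q h" "\<rho> \<in> tuples P" "x \<in> carrier P"
  shows "h (word_map P W \<rho> x) = word_map Q W (h \<circ> \<rho>) (h x)"
proof -
  have "h \<circ> case_nat x \<rho> = case_nat (h x) (h \<circ> \<rho>)"
    by (auto split: nat.split)
  moreover have "h x \<in> carrier Q"
    using assms by (auto simp: loop_hom_def)
  ultimately show ?thesis
    using assms loop_hom_tuples[OF assms(3,4)]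
    by (simp add: loop.word_map_eval loop_hom_eval loop.case_nat_tuples)
qed

section \<open>Congruences and normal subloops\<close>

context loop
begin

lemma congruence_ops:
  assumes "congruence Q \<delta>" "(a, b) \<in> \<delta>" "(c, d) \<in> \<delta>"
  shows "(a \<otimes> c, b \<otimes> d) \<in> \<delta>" "(a \<setminus> c, b \<setminus> d) \<in> \<delta>" "(a \<oslash> c, b \<oslash> d) \<in> \<delta>"
  using assms unfolding congruence_def by blast+

lemma congruence_refl: "\<lbrakk>congruence Q \<delta>; a \<in> carrier Q\<rbrakk> \<Longrightarrow> (a, a) \<in> \<delta>"
  by (auto simp: congruence_def equiv_def dest: refl_onD)

lemma congruence_sym: "\<lbrakk>congruence Q \<delta>; (a, b) \<in> \<delta>\<rbrakk> \<Longrightarrow> (b, a) \<in> \<delta>"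
  by (auto simp: congruence_def equiv_def dest: symD)

lemma congruence_trans: "\<lbrakk>congruence Q \<delta>; (a, b) \<in> \<delta>; (b, c) \<in> \<delta>\<rbrakk> \<Longrightarrow> (a, c) \<in> \<delta>"
  unfolding congruence_def equiv_def by (meson transD)

lemma congruence_carrier:
  assumes "congruence Q \<delta>" "(a, b) \<in> \<delta>"
  shows "a \<in> carrier Q" "b \<in> carrier Q"
  using assms by (auto simp: congruence_def equiv_def)

lemma congruence_eval:
  assumes "congruence Q \<delta>" "\<And>i. (\<rho> i, \<sigma> i) \<in> \<delta>"
  shows "(eval Q \<rho> t, eval Q \<sigma> t) \<in> \<delta>"
  using assms by (induction t) (auto intro: congruence_ops congruence_refl one_closed)

lemma congruence_signed_letter_map:
  assumes "congruence Q \<delta>" "\<rho> \<in> tuples Q" "(x, y) \<in> \<delta>"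
  shows "(signed_letter_map Q \<rho> l x, signed_letter_map Q \<rho> l y) \<in> \<delta>"
proof -
  \<comment> \<open>The two valuations differ only in variable 0; on the parameters reflexivity
    suffices.\<close>
  have "(case_nat x \<rho> i, case_nat y \<rho> i) \<in> \<delta>" for i
    using assms by (auto simp: tuples_def Pi_iff congruence_refl split: nat.split)
  then show ?thesis
    using congruence_eval[OF assms(1), of "case_nat x \<rho>" "case_nat y \<rho>" "letter_term l (Var 0)"]
      signed_letter_map_eval[OF assms(2), of x "Var 0" l]
      signed_letter_map_eval[OF assms(2), of y "Var 0" l]
      congruence_carrier[OF assms(1,3)]
    by simp
qed

text \<open>The letter of opposite sign undoes the mapping and respects the congruence as well,
  which gives the direction from left to right.\<close>

lemma congruence_signed_letter_map_iff:
  assumes "congruence Q \<delta>" "\<rho> \<in> tuples Q" "x \<in> carrier Q" "y \<in> carrier Q"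
  shows "(signed_letter_map Q \<rho> l x, signed_letter_map Q \<rho> l y) \<in> \<delta> \<longleftrightarrow> (x, y) \<in> \<delta>"
proof -
  obtain e k where "l = (e, k)" by fastforce
  then show ?thesis
    using congruence_signed_letter_map[OF assms(1,2)] signed_letter_map_cancel[OF assms(2)] assms
    by metis
qed

text \<open>Reflecting the congruence matters as much as preserving it: words get cancelled from
  both sides later, and inverses of word maps have to be controlled.\<close>

lemma congruence_word_map_iff:
  assumes "congruence Q \<delta>" "\<rho> \<in> tuples Q" "x \<in> carrier Q" "y \<in> carrier Q"
  shows "(word_map Q W \<rho> x, word_map Q W \<rho> y) \<in> \<delta> \<longleftrightarrow> (x, y) \<in> \<delta>"
proof -
  have "(letters_map Q \<rho> w x, letters_map Q \<rho> w y) \<in> \<delta> \<longleftrightarrow> (x, y) \<in> \<delta>" for w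
  proof (induction w)
    case Nil
    show ?case using assms by (simp add: letters_map_Nil)
  next
    case (Cons l w)
    have "letters_map Q \<rho> w x \<in> carrier Q" "letters_map Q \<rho> w y \<in> carrier Q"
      using Bij_imp_funcset[OF letters_map_Bij[OF assms(2)], of w] assms(3,4) by auto
    then show ?case
      using Cons assms by (simp add: letters_map_step congruence_signed_letter_map_iff)
  qed
  then show ?thesis
    by (simp add: word_map_letters)
qed

section \<open>Correspondence between congruences and normal subloops\<close>

lemma congruence_rdiv_iff:
  assumes "congruence Q \<delta>" "a \<in> carrier Q" "b \<in> carrier Q"
  shows "a \<oslash> b \<in> kernel_of Q \<delta> \<longleftrightarrow> (a, b) \<in> \<delta>"
proof
  assume "a \<oslash> b \<in> kernel_of Q \<delta>"
  then have "((a \<oslash> b) \<otimes> b, \<one> \<otimes> b) \<in> \<delta>"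
    using assms by (intro congruence_ops) (auto simp: kernel_of_def congruence_refl)
  then show "(a, b) \<in> \<delta>"
    using assms by (simp add: cancel l_one)
next
  assume "(a, b) \<in> \<delta>"
  then have "(a \<oslash> b, b \<oslash> b) \<in> \<delta>"
    using assms by (intro congruence_ops) (auto simp: congruence_refl)
  then show "a \<oslash> b \<in> kernel_of Q \<delta>"
    using assms by (simp add: kernel_of_def rdiv_self closed)
qed

lemma cong_of_kernel: "congruence Q \<delta> \<Longrightarrow> cong_of Q (kernel_of Q \<delta>) = \<delta>"
  using congruence_rdiv_iff congruence_carrier by (auto simp: cong_of_def)

text \<open>Translating a class by an element yields a full class, because the division undoing the
  translation respects the congruence too. The kernel is the class of 1, so both sides of each
  normality equation are the class of the same product.\<close>

lemma kernel_normal: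
  assumes "congruence Q \<delta>"
  shows "normal_subloop (kernel_of Q \<delta>) Q"
proof -
  note cg = congruence_ops[OF assms] congruence_refl[OF assms] congruence_carrier[OF assms]
  let ?N = "kernel_of Q \<delta>"
  have l: "x <# (\<delta> `` {y}) = \<delta> `` {x \<otimes> y}" if "x \<in> carrier Q" "y \<in> carrier Q" for x y
  proof (intro equalityI subsetI)
    fix z assume "z \<in> x <# (\<delta> `` {y})"
    then show "z \<in> \<delta> `` {x \<otimes> y}"
      using that cg by (auto simp: l_coset_def)
  next
    fix z assume z: "z \<in> \<delta> `` {x \<otimes> y}"
    then have "(x \<setminus> (x \<otimes> y), x \<setminus> z) \<in> \<delta>"
      using that cg by blast
    then have "x \<setminus> z \<in> \<delta> `` {y}" "z = x \<otimes> (x \<setminus> z)"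
      using that z cg by (auto simp: cancel)
    then show "z \<in> x <# (\<delta> `` {y})"
      unfolding l_coset_def by blast
  qed
  have r: "(\<delta> `` {x}) #> y = \<delta> `` {x \<otimes> y}" if "x \<in> carrier Q" "y \<in> carrier Q" for x y
  proof (intro equalityI subsetI)
    fix z assume "z \<in> (\<delta> `` {x}) #> y"
    then show "z \<in> \<delta> `` {x \<otimes> y}"
      using that cg by (auto simp: r_coset_def)
  next
    fix z assume z: "z \<in> \<delta> `` {x \<otimes> y}"
    then have "((x \<otimes> y) \<oslash> y, z \<oslash> y) \<in> \<delta>"
      using that cg by blast
    then have "z \<oslash> y \<in> \<delta> `` {x}" "z = (z \<oslash> y) \<otimes> y"
      using that z cg by (auto simp: cancel)
    then show "z \<in> (\<delta> `` {x}) #> y"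
      unfolding r_coset_def by blast
  qed
  have N: "?N = \<delta> `` {\<one>}"
    using congruence_sym[OF assms] cg by (auto simp: kernel_of_def)
  have "subloop ?N Q"
    unfolding subloop_def
  proof (intro conjI ballI)
    fix x y assume "x \<in> ?N" "y \<in> ?N"
    then have xy: "(x, \<one>) \<in> \<delta>" "(y, \<one>) \<in> \<delta>" "x \<in> carrier Q" "y \<in> carrier Q"
      by (auto simp: kernel_of_def)
    show "x \<otimes> y \<in> ?N" "x \<setminus> y \<in> ?N" "x \<oslash> y \<in> ?N"
      using cg(1)[OF xy(1,2)] cg(2)[OF xy(1,2)] cg(3)[OF xy(1,2)] xy
      by (auto simp: kernel_of_def closed r_one ldiv_self rdiv_self)
  qed (auto simp: kernel_of_def closed cg)
  then show ?thesis
    unfolding normal_subloop_def N by (simp add: l r closed r_one l_one)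
qed

text \<open>Equality of right cosets makes it evident that \<open>cong_of Q N\<close> is an
  equivalence. From right to left, N(a \<oslash> b) = N because N is a subloop, and normality turns
  right multiplication by b into Na = Nb.\<close>

lemma r_coset_eq_iff:
  assumes "normal_subloop N Q" "a \<in> carrier Q" "b \<in> carrier Q"
  shows "N #> a = N #> b \<longleftrightarrow> a \<oslash> b \<in> N"
proof -
  have sub: "subloop N Q" and NC: "N \<subseteq> carrier Q"
    using assms by (auto simp: normal_subloop_def subloop_def)
  show ?thesis
  proof
    assume "N #> a = N #> b"
    moreover have "a \<in> N #> a"
      using sub assms unfolding r_coset_def subloop_def by (metis UN_I l_one singletonI)
    ultimately obtain n where "n \<in> N" "a = n \<otimes> b"
      unfolding r_coset_def by auto
    then show "a \<oslash> b \<in> N"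
      using NC assms by (auto simp: cancel)
  next
    assume n: "a \<oslash> b \<in> N"
    then have "N #> (a \<oslash> b) = N"
    proof -
      have "m \<otimes> (a \<oslash> b) \<in> N" if "m \<in> N" for m
        using sub n that by (auto simp: subloop_def)
      moreover have "m \<in> N #> (a \<oslash> b)" if "m \<in> N" for m
      proof -
        have "m \<oslash> (a \<oslash> b) \<in> N" "m = (m \<oslash> (a \<oslash> b)) \<otimes> (a \<oslash> b)"
          using sub n that NC by (auto simp: subloop_def rdiv_mult subset_iff)
        then show ?thesis unfolding r_coset_def by blast
      qed
      ultimately show ?thesis unfolding r_coset_def by auto
    qed
    moreover have "N #> ((a \<oslash> b) \<otimes> b) = (N #> (a \<oslash> b)) #> b"
      using assms by (simp add: normal_subloop_def closed)
    ultimately show "N #> a = N #> b"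
      using assms by (simp add: cancel)
  qed
qed

lemma l_coset_inj:
  assumes "x \<in> carrier Q" "K \<subseteq> carrier Q" "N \<subseteq> carrier Q" "x <# K = x <# N"
  shows "K = N"
proof -
  have "(\<lambda>y. x \<otimes> y) ` K = (\<lambda>y. x \<otimes> y) ` N"
    using assms(4) by (auto simp: l_coset_def)
  moreover have "inj_on (\<lambda>y. x \<otimes> y) (carrier Q)"
    by (rule inj_onI) (metis assms(1) ldiv_mult)
  ultimately show ?thesis
    using assms(2,3) inj_on_image_eq_iff by blast
qed

lemma r_coset_inj:
  assumes "x \<in> carrier Q" "K \<subseteq> carrier Q" "N \<subseteq> carrier Q" "K #> x = N #> x"
  shows "K = N"
proof -
  have "(\<lambda>y. y \<otimes> x) ` K = (\<lambda>y. y \<otimes> x) ` N"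
    using assms(4) by (auto simp: r_coset_def)
  moreover have "inj_on (\<lambda>y. y \<otimes> x) (carrier Q)"
    by (rule inj_onI) (metis assms(1) mult_rdiv)
  ultimately show ?thesis
    using assms(2,3) inj_on_image_eq_iff by blast
qed

text \<open>In terms of right cosets, products are handled by N(xy) = (Nx)y = x(Ny). For a division,
  multiply it back and cancel: translations are injective on subsets of the carrier.\<close>

lemma cong_of_congruence:
  assumes "normal_subloop N Q"
  shows "congruence Q (cong_of Q N)"
proof -
  have iff: "(a, b) \<in> cong_of Q N \<longleftrightarrow> a \<in> carrier Q \<and> b \<in> carrier Q \<and> N #> a = N #> b" for a b
    using r_coset_eq_iff[OF assms] by (auto simp: cong_of_def)
  have NC: "N #> a \<subseteq> carrier Q" if "a \<in> carrier Q" for a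
    using assms that by (auto simp: r_coset_def normal_subloop_def subloop_def closed)
  have r: "N #> (x \<otimes> y) = (N #> x) #> y" if "x \<in> carrier Q" "y \<in> carrier Q" for x y
    using assms that by (auto simp: normal_subloop_def)
  \<comment> \<open>N(xy) = (xy)N = x(yN) = x(Ny).\<close>
  have l: "N #> (x \<otimes> y) = x <# (N #> y)" if "x \<in> carrier Q" "y \<in> carrier Q" for x y
    using assms that closed(2)[OF that] unfolding normal_subloop_def by metis
  have "equiv (carrier Q) (cong_of Q N)"
    by (auto simp: equiv_def refl_on_def sym_def trans_def iff)
  moreover have "(a \<otimes> c, b \<otimes> d) \<in> cong_of Q N" "(a \<setminus> c, b \<setminus> d) \<in> cong_of Q N"
      "(a \<oslash> c, b \<oslash> d) \<in> cong_of Q N"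
    if "(a, b) \<in> cong_of Q N" "(c, d) \<in> cong_of Q N" for a b c d
  proof -
    have C: "a \<in> carrier Q" "b \<in> carrier Q" "c \<in> carrier Q" "d \<in> carrier Q"
      and ab: "N #> a = N #> b" and cd: "N #> c = N #> d"
      using that by (auto simp: iff)
    have "N #> (a \<otimes> c) = N #> (b \<otimes> c)"
      using C by (simp add: r ab)
    also have "\<dots> = N #> (b \<otimes> d)"
      using C by (simp add: l cd)
    finally show "(a \<otimes> c, b \<otimes> d) \<in> cong_of Q N"
      using C by (simp add: iff closed)
    have "a <# (N #> (a \<setminus> c)) = N #> c"
      using C l[of a "a \<setminus> c"] by (simp add: closed cancel)
    also have "\<dots> = N #> (b \<otimes> (b \<setminus> d))"
      using C cd by (simp add: cancel)
    \<comment> \<open>With e = b \<setminus> d: N(be) = (Nb)e = (Na)e = N(ae) = a(Ne).\<close>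
    also have "\<dots> = a <# (N #> (b \<setminus> d))"
      using C r[of a "b \<setminus> d"] l[of a "b \<setminus> d"] r[of b "b \<setminus> d"] ab by (simp add: closed)
    finally show "(a \<setminus> c, b \<setminus> d) \<in> cong_of Q N"
      using C l_coset_inj[of a] NC by (simp add: iff closed)
    have "(N #> (a \<oslash> c)) #> c = N #> a"
      using C r[of "a \<oslash> c" c] by (simp add: closed cancel)
    also have "\<dots> = N #> ((b \<oslash> d) \<otimes> d)"
      using C ab by (simp add: cancel)
    \<comment> \<open>With e = b \<oslash> d: N(ed) = e(Nd) = e(Nc) = N(ec) = (Ne)c.\<close>
    also have "\<dots> = (N #> (b \<oslash> d)) #> c"
      using C l[of "b \<oslash> d" c] l[of "b \<oslash> d" d] r[of "b \<oslash> d" c] cd by (simp add: closed)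
    finally show "(a \<oslash> c, b \<oslash> d) \<in> cong_of Q N"
      using C r_coset_inj[of c] NC by (simp add: iff closed)
  qed
  ultimately show ?thesis
    unfolding congruence_def by blast
qed

lemma kernel_of_cong: "N \<subseteq> carrier Q \<Longrightarrow> kernel_of Q (cong_of Q N) = N"
  by (auto simp: kernel_of_def cong_of_def rdiv_one closed)

lemma cong_of_one_iff: "x \<in> carrier Q \<Longrightarrow> (x, \<one>) \<in> cong_of Q N \<longleftrightarrow> x \<in> N"
  by (simp add: cong_of_def rdiv_one closed)

text \<open>Left division recovers the denominator: (p \<oslash> x) \<setminus> p = x. This is the
  last step in verifying the term condition for D.\<close>

lemma congruence_cancel_rdiv:
  assumes "congruence Q \<delta>" "(p \<oslash> x, q \<oslash> y) \<in> \<delta>" "(p, q) \<in> \<delta>" "x \<in> carrier Q" "y \<in> carrier Q"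
  shows "(x, y) \<in> \<delta>"
  using congruence_ops(2)[OF assms(1-3)] congruence_carrier[OF assms(1,3)] assms(4,5)
  by (simp add: ldiv_rdiv)

text \<open>\<open>LEAST\<close> is informative only once a least candidate is exhibited. It is the
  intersection of all normal subloops containing X, which is normal as the kernel of the
  intersection of their congruences.\<close>

lemma Ng_least:
  assumes "X \<subseteq> carrier Q"
  shows "normal_subloop (Ng Q X) Q" "X \<subseteq> Ng Q X"
    and "\<lbrakk>normal_subloop N Q; X \<subseteq> N\<rbrakk> \<Longrightarrow> Ng Q X \<subseteq> N"
proof -
  define \<C> where "\<C> = {N. normal_subloop N Q \<and> X \<subseteq> N}"
  define \<delta> where "\<delta> = {(a, b). a \<in> carrier Q \<and> b \<in> carrier Q \<and> (\<forall>N \<in> \<C>. (a, b) \<in> cong_of Q N)}"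
  have cg: "congruence Q (cong_of Q N)" if "N \<in> \<C>" for N
    using that cong_of_congruence by (simp add: \<C>_def)
  have "equiv (carrier Q) \<delta>"
    unfolding equiv_def refl_on_def sym_def trans_def \<delta>_def
    using congruence_refl[OF cg] congruence_sym[OF cg] congruence_trans[OF cg] by blast
  then have "congruence Q \<delta>"
    unfolding congruence_def \<delta>_def using congruence_ops[OF cg] by (auto simp: closed)
  then have "normal_subloop (kernel_of Q \<delta>) Q"
    by (rule kernel_normal)
  moreover have ker: "kernel_of Q \<delta> = carrier Q \<inter> \<Inter>\<C>"
    by (auto simp: kernel_of_def \<delta>_def cong_of_one_iff closed)
  ultimately have least: "normal_subloop (kernel_of Q \<delta>) Q \<and> X \<subseteq> kernel_of Q \<delta>"
    "\<And>N. normal_subloop N Q \<and> X \<subseteq> N \<Longrightarrow> kernel_of Q \<delta> \<subseteq> N"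
    using assms by (auto simp: \<C>_def)
  then have "Ng Q X = kernel_of Q \<delta>"
    unfolding Ng_def by (intro Least_equality)
  with least show "normal_subloop (Ng Q X) Q" "X \<subseteq> Ng Q X"
    by simp_all
  show "Ng Q X \<subseteq> N" if "normal_subloop N Q" "X \<subseteq> N"
    using least(2)[of N] that \<open>Ng Q X = kernel_of Q \<delta>\<close> by simp
qed

section \<open>Inner mappings and normality\<close>

lemma TMlt_closed:
  shows "x \<in> carrier Q \<Longrightarrow> Lmap Q x \<in> TMlt Q" "x \<in> carrier Q \<Longrightarrow> Rmap Q x \<in> TMlt Q"
    and "x \<in> carrier Q \<Longrightarrow> (\<lambda>y \<in> carrier Q. x \<setminus> y) \<in> TMlt Q"
    and "x \<in> carrier Q \<Longrightarrow> (\<lambda>y \<in> carrier Q. y \<oslash> x) \<in> TMlt Q"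
    and "\<lbrakk>f \<in> TMlt Q; g \<in> TMlt Q\<rbrakk> \<Longrightarrow> compose (carrier Q) f g \<in> TMlt Q"
proof -
  let ?H = "Lmap Q ` carrier Q \<union> Rmap Q ` carrier Q \<union> Mmap Q ` carrier Q"
  show "Lmap Q x \<in> TMlt Q" if "x \<in> carrier Q"
    using generate.incl[of "Lmap Q x" ?H] that unfolding TMlt_def by blast
  show "Rmap Q x \<in> TMlt Q" if "x \<in> carrier Q"
    using generate.incl[of "Rmap Q x" ?H] that unfolding TMlt_def by blast
  show "(\<lambda>y \<in> carrier Q. x \<setminus> y) \<in> TMlt Q" if "x \<in> carrier Q"
    using generate.inv[of "Lmap Q x" ?H] that
    unfolding TMlt_def inv_translations(1)[OF that, symmetric] by blast
  show "(\<lambda>y \<in> carrier Q. y \<oslash> x) \<in> TMlt Q" if "x \<in> carrier Q"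
    using generate.inv[of "Rmap Q x" ?H] that
    unfolding TMlt_def inv_translations(2)[OF that, symmetric] by blast
  assume fg: "f \<in> TMlt Q" "g \<in> TMlt Q"
  \<comment> \<open>Multiplication in \<open>BijGroup\<close> is composition only on members of
    \<open>Bij\<close>, so membership comes first.\<close>
  have "TMlt Q \<subseteq> Bij (carrier Q)"
    unfolding TMlt_def carrier_BijGroup[symmetric]
    by (intro group.generate_incl group_BijGroup) (auto simp: carrier_BijGroup translations_Bij)
  with fg have "f \<otimes>\<^bsub>BijGroup (carrier Q)\<^esub> g = compose (carrier Q) f g"
    by (auto simp: BijGroup_def)
  with fg show "compose (carrier Q) f g \<in> TMlt Q"
    unfolding TMlt_def by (metis generate.eng)
qed

text \<open>Each coset inclusion asks to rewrite a product with z in N as one with some z' in N.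
  Solving for z' by division expresses it as the image of z under a product of translations that
  fixes 1.\<close>

lemma TInn_invariant_normal:
  assumes sub: "subloop N Q" and inv: "\<And>f z. \<lbrakk>f \<in> TInn Q; z \<in> N\<rbrakk> \<Longrightarrow> f z \<in> N"
  shows "normal_subloop N Q"
proof -
  have NC: "\<And>z. z \<in> N \<Longrightarrow> z \<in> carrier Q"
    using sub by (auto simp: subloop_def)
  have T: "f z \<in> N" if "f \<in> TMlt Q" "f \<one> = \<one>" "z \<in> N" for f z
    using inv that by (simp add: TInn_def)
  have T2: "f (g z) \<in> N" if "f \<in> TMlt Q" "g \<in> TMlt Q" "f (g \<one>) = \<one>" "z \<in> N" for f g z
    using T[OF TMlt_closed(5)[OF that(1,2)] _ that(4)] that(3) NC[OF that(4)]
    by (simp add: compose_eq one_closed)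
  have T3: "f (g (h z)) \<in> N"
    if "f \<in> TMlt Q" "g \<in> TMlt Q" "h \<in> TMlt Q" "f (g (h \<one>)) = \<one>" "z \<in> N" for f g h z
    using T2[OF that(1) TMlt_closed(5)[OF that(2,3)] _ that(5)] that(4) NC[OF that(5)]
    by (simp add: compose_eq one_closed)
  note simps = Lmap_def Rmap_def closed cancel r_one l_one rdiv_self ldiv_self NC
  \<comment> \<open>The inner mapping R_x^{-1} L_x and its inverse; in each of these three facts the
    two mutually inverse mappings serve the two opposite inclusions.\<close>
  have conj: "(x \<otimes> z) \<oslash> x \<in> N" "x \<setminus> (z \<otimes> x) \<in> N" if "x \<in> carrier Q" "z \<in> N" for x z
    using T2[OF TMlt_closed(4,1)[OF that(1)] _ that(2)] T2[OF TMlt_closed(3,2)[OF that(1)] _ that(2)]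
      that
    by (simp_all add: simps)
  \<comment> \<open>L_{xy}^{-1} L_x L_y and its inverse.\<close>
  have left: "(x \<otimes> y) \<setminus> (x \<otimes> (y \<otimes> z)) \<in> N" "y \<setminus> (x \<setminus> ((x \<otimes> y) \<otimes> z)) \<in> N"
    if "x \<in> carrier Q" "y \<in> carrier Q" "z \<in> N" for x y z
    using T3[OF TMlt_closed(3)[OF mult_closed[OF that(1,2)]] TMlt_closed(1)[OF that(1)]
        TMlt_closed(1)[OF that(2)] _ that(3)]
      T3[OF TMlt_closed(3)[OF that(2)] TMlt_closed(3)[OF that(1)]
        TMlt_closed(1)[OF mult_closed[OF that(1,2)]] _ that(3)] that
    by (simp_all add: simps)
  \<comment> \<open>R_{xy}^{-1} R_y R_x and its inverse.\<close>
  have right: "((z \<otimes> x) \<otimes> y) \<oslash> (x \<otimes> y) \<in> N" "((z \<otimes> (x \<otimes> y)) \<oslash> y) \<oslash> x \<in> N"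
    if "x \<in> carrier Q" "y \<in> carrier Q" "z \<in> N" for x y z
    using T3[OF TMlt_closed(4)[OF mult_closed[OF that(1,2)]] TMlt_closed(2)[OF that(2)]
        TMlt_closed(2)[OF that(1)] _ that(3)]
      T3[OF TMlt_closed(4)[OF that(1)] TMlt_closed(4)[OF that(2)]
        TMlt_closed(2)[OF mult_closed[OF that(1,2)]] _ that(3)] that
    by (simp_all add: simps)
  have lI: "x \<otimes> z \<in> x <# K" and rI: "z \<otimes> x \<in> K #> x" if "z \<in> K" for x z K
    using that by (auto simp: l_coset_def r_coset_def)
  show ?thesis
    unfolding normal_subloop_def
  proof (intro conjI ballI sub)
    fix x y assume xy: "x \<in> carrier Q" "y \<in> carrier Q"
    show "x <# N = N #> x"
    proof
      show "x <# N \<subseteq> N #> x"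
        using rI[OF conj(1)[OF xy(1)], of _ x] xy by (auto simp: l_coset_def simps)
      show "N #> x \<subseteq> x <# N"
        using lI[OF conj(2)[OF xy(1)], of _ x] xy by (auto simp: r_coset_def simps)
    qed
    show "x <# (y <# N) = (x \<otimes> y) <# N"
    proof
      show "x <# (y <# N) \<subseteq> (x \<otimes> y) <# N"
        using lI[OF left(1)[OF xy], of _ "x \<otimes> y"] xy by (auto simp: l_coset_def simps)
      show "(x \<otimes> y) <# N \<subseteq> x <# (y <# N)"
        using lI[OF lI[OF left(2)[OF xy], of _ y], of _ x] xy by (auto simp: l_coset_def simps)
    qed
    show "N #> (x \<otimes> y) = (N #> x) #> y"
    proof
      show "(N #> x) #> y \<subseteq> N #> (x \<otimes> y)"
        using rI[OF right(1)[OF xy], of _ "x \<otimes> y"] xy by (auto simp: r_coset_def simps)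
      show "N #> (x \<otimes> y) \<subseteq> (N #> x) #> y"
        using rI[OF rI[OF right(2)[OF xy], of _ x], of _ y] xy by (auto simp: r_coset_def simps)
    qed
  qed
qed

end

section \<open>A congruence as a loop of pairs\<close>

text \<open>
  The injection \<open>j\<close> encodes pairs in a single type, since a variety only contains loops over a
  fixed type.
\<close>

definition pair_loop ::
  "('a, 'm) loop_scheme \<Rightarrow> ('a \<times> 'a) set \<Rightarrow> ('a \<times> 'a \<Rightarrow> 'b) \<Rightarrow> 'b loop" where
  "pair_loop Q \<beta> j = (let p = (\<lambda>z. fst (inv_into UNIV j z)); q = (\<lambda>z. snd (inv_into UNIV j z)) in
     \<lparr>carrier = j ` \<beta>,
      mult = \<lambda>z w. j (p z \<otimes>\<^bsub>Q\<^esub> p w, q z \<otimes>\<^bsub>Q\<^esub> q w),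
      one = j (\<one>\<^bsub>Q\<^esub>, \<one>\<^bsub>Q\<^esub>),
      ldiv = \<lambda>z w. j (p z \<setminus>\<^bsub>Q\<^esub> p w, q z \<setminus>\<^bsub>Q\<^esub> q w),
      rdiv = \<lambda>z w. j (p z \<oslash>\<^bsub>Q\<^esub> p w, q z \<oslash>\<^bsub>Q\<^esub> q w)\<rparr>)"

text \<open>A congruence is closed under componentwise operations. Identities pass from Q to P
  because the two projections are homomorphisms into Q that jointly separate points.\<close>

lemma (in loop) pair_loop:
  assumes \<beta>: "congruence Q \<beta>" and j: "inj j"
  defines "P \<equiv> pair_loop Q \<beta> j"
  shows "loop P"
    and "loop_hom P Q (\<lambda>z. fst (inv_into UNIV j z))"
    and "loop_hom P Q (\<lambda>z. snd (inv_into UNIV j z))"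
    and "satisfies Q E \<Longrightarrow> satisfies P E"
proof -
  note cg = congruence_ops[OF \<beta>] congruence_refl[OF \<beta>] congruence_carrier[OF \<beta>]
  have [simp]: "inv_into UNIV j (j z) = z" for z
    using j by simp
  note simps = P_def pair_loop_def Let_def closed cancel l_one r_one
  show P: "loop P"
    by unfold_locales (auto simp: simps cg(5,6) intro!: imageI intro: cg(1-4))
  show h1: "loop_hom P Q (\<lambda>z. fst (inv_into UNIV j z))"
    and h2: "loop_hom P Q (\<lambda>z. snd (inv_into UNIV j z))"
    by (auto simp: simps loop_hom_def dest: cg(5,6))
  assume E: "satisfies Q E"
  show "satisfies P E"
    unfolding satisfies_def
  proof (safe)
    fix s t \<rho> assume st: "(s, t) \<in> E" and \<rho>: "\<rho> \<in> tuples P"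
    have eq: "eval Q \<sigma> s = eval Q \<sigma> t" if "\<sigma> \<in> tuples Q" for \<sigma>
      using E st that by (auto simp: satisfies_def)
    have "inv_into UNIV j (eval P \<rho> s) = inv_into UNIV j (eval P \<rho> t)"
      using loop_hom_eval[OF P h1 \<rho>] eq[OF loop_hom_tuples[OF h1 \<rho>]]
        loop_hom_eval[OF P h2 \<rho>] eq[OF loop_hom_tuples[OF h2 \<rho>]]
      by (simp add: prod_eq_iff)
    moreover have "eval P \<rho> s \<in> range j" "eval P \<rho> t \<in> range j"
      using loop.eval_closed[OF P \<rho>] by (fastforce simp: P_def pair_loop_def Let_def)+
    ultimately show "eval P \<rho> s = eval P \<rho> t"
      by (metis f_inv_into_f)
  qed
qed

text \<open>An infinite set is equinumerous with its square. Infinitude of the universe enters here: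
  it allows the loop of pairs to live on the same type as Q.\<close>

lemma infinite_inj_pairs: "\<exists>j :: 'a::infinite \<times> 'a \<Rightarrow> 'a. inj j"
proof -
  have "\<exists>j. bij_betw j ((UNIV :: 'a set) \<times> (UNIV :: 'a set)) (UNIV :: 'a set)"
    unfolding card_of_ordIso by (rule card_of_Times_same_infinite[OF infinite_UNIV])
  then show ?thesis
    by (auto simp: bij_betw_def)
qed

section \<open>The commutator\<close>

definition word_quotients ::
  "('a, 'm) loop_scheme \<Rightarrow> loop_word set \<Rightarrow> 'a set \<Rightarrow> 'a set \<Rightarrow> 'a set" where
  "word_quotients Q \<W> A B = {word_map Q W u a \<oslash>\<^bsub>Q\<^esub> word_map Q W v a | W a u v.
     W \<in> \<W> \<and> a \<in> A \<and> u \<in> tuples Q \<and> v \<in> tuples Q \<and> (\<forall>i. u i \<oslash>\<^bsub>Q\<^esub> v i \<in> B)}"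

lemma word_quotientsI:
  "\<lbrakk>W \<in> \<W>; a \<in> A; u \<in> tuples Q; v \<in> tuples Q; \<And>i. u i \<oslash>\<^bsub>Q\<^esub> v i \<in> B\<rbrakk> \<Longrightarrow>
    word_map Q W u a \<oslash>\<^bsub>Q\<^esub> word_map Q W v a \<in> word_quotients Q \<W> A B"
  unfolding word_quotients_def by blast

text \<open>The lower bound for the commutator: the term condition is applied to
  \<open>word_term W\<close> with variable 0 moving from 1 to a.\<close>

lemma word_quotients_centralizer:
  assumes "loop Q" "congruence Q \<delta>" "centralizes Q (cong_of Q A) (cong_of Q B) \<delta>"
    and A: "normal_subloop A Q"
    and fixed: "\<And>W \<rho>. \<lbrakk>W \<in> \<W>; \<rho> \<in> tuples Q\<rbrakk> \<Longrightarrow> word_map Q W \<rho> \<one>\<^bsub>Q\<^esub> = \<one>\<^bsub>Q\<^esub>"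
  shows "word_quotients Q \<W> A B \<subseteq> kernel_of Q \<delta>"
proof -
  interpret loop Q by fact
  have "word_map Q W u a \<oslash>\<^bsub>Q\<^esub> word_map Q W v a \<in> kernel_of Q \<delta>"
    if W: "W \<in> \<W>" and a: "a \<in> A" and uv: "u \<in> tuples Q" "v \<in> tuples Q" "\<forall>i. u i \<oslash>\<^bsub>Q\<^esub> v i \<in> B"
    for W a u v
  proof -
    have aC: "a \<in> carrier Q"
      using A a by (auto simp: normal_subloop_def subloop_def)
    have "(\<one>\<^bsub>Q\<^esub>, a) \<in> cong_of Q A"
      using congruence_sym[OF cong_of_congruence[OF A]] a aC by (simp add: cong_of_one_iff)
    moreover have "(u i, v i) \<in> cong_of Q B" for i
      using uv by (auto simp: cong_of_def tuples_def)
    \<comment> \<open>Both values are 1, so the premise of the term condition is mere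
      reflexivity.\<close>
    moreover have "(word_map Q W u \<one>\<^bsub>Q\<^esub>, word_map Q W v \<one>\<^bsub>Q\<^esub>) \<in> \<delta>"
      using fixed W uv assms(2) by (simp add: congruence_refl closed)
    ultimately have "(word_map Q W u a, word_map Q W v a) \<in> \<delta>"
      using assms(3) uv aC unfolding centralizes_def by (simp add: word_map_eval closed)
    then show ?thesis
      using assms(2) uv aC by (simp add: congruence_rdiv_iff word_map_closed)
  qed
  then show ?thesis
    unfolding word_quotients_def by blast
qed

text \<open>Invariance under \<open>TInn P\<close> need only be checked on the generating word maps.
  Through p and q such a map acts on the two components with parameter tuples congruent modulo B,
  and the resulting discrepancy on A is a word quotient, hence in D.\<close>

lemma normal_pairs:
  assumes P: "loop P" and Q: "loop Q" and p: "loop_hom P Q p" and q: "loop_hom P Q q"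
    and A: "normal_subloop A Q" and D: "normal_subloop D Q"
    and pqB: "\<And>z. z \<in> carrier P \<Longrightarrow> p z \<oslash>\<^bsub>Q\<^esub> q z \<in> B"
    and quot: "word_quotients Q \<W> A B \<subseteq> D"
    and fixed: "\<And>W \<rho>. \<lbrakk>W \<in> \<W>; \<rho> \<in> tuples Q\<rbrakk> \<Longrightarrow> word_map Q W \<rho> \<one>\<^bsub>Q\<^esub> = \<one>\<^bsub>Q\<^esub>"
    and gen: "TInn P =
      generate (BijGroup (carrier P)) {word_map P W \<rho> | W \<rho>. W \<in> \<W> \<and> \<rho> \<in> tuples P}"
  shows "normal_subloop {z \<in> carrier P. p z \<in> A \<and> (p z, q z) \<in> cong_of Q D} P"
    (is "normal_subloop ?S P")
proof -
  interpret P: loop P by fact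
  interpret Q: loop Q by fact
  note cA = Q.cong_of_congruence[OF A] and cD = Q.cong_of_congruence[OF D]
  have pC: "p z \<in> carrier Q" and qC: "q z \<in> carrier Q" if "z \<in> carrier P" for z
    using p q that by (auto simp: loop_hom_def)
  \<comment> \<open>An equivalence, so that inverses of the generators preserve S as well.\<close>
  have word_iff: "word_map P W \<rho> z \<in> ?S \<longleftrightarrow> z \<in> ?S"
    if W: "W \<in> \<W>" and \<rho>: "\<rho> \<in> tuples P" and z: "z \<in> carrier P" for W \<rho> z
  proof -
    let ?u = "p \<circ> \<rho>" and ?v = "q \<circ> \<rho>"
    have u: "?u \<in> tuples Q" and v: "?v \<in> tuples Q"
      using loop_hom_tuples p q \<rho> by blast+
    \<comment> \<open>Membership in A means congruence to 1, and 1 is also the value of the word at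
      1; the word then cancels.\<close>
    have "word_map Q W ?u (p z) \<in> A \<longleftrightarrow>
      (word_map Q W ?u (p z), word_map Q W ?u \<one>\<^bsub>Q\<^esub>) \<in> cong_of Q A"
      using fixed[OF W u] Q.cong_of_one_iff Q.word_map_closed[OF u pC[OF z]] by simp
    also have "\<dots> \<longleftrightarrow> p z \<in> A"
      using Q.congruence_word_map_iff[OF cA u] pC[OF z] by (simp add: Q.cong_of_one_iff Q.closed)
    finally have inA: "word_map Q W ?u (p z) \<in> A \<longleftrightarrow> p z \<in> A" .
    have "(word_map Q W ?u (p z), word_map Q W ?v (q z)) \<in> cong_of Q D \<longleftrightarrow>
        (p z, q z) \<in> cong_of Q D" if "p z \<in> A"
    proof -
      \<comment> \<open>First exchange the parameters u for v at the fixed argument p z, at the cost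
        of a word quotient; then cancel the common word.\<close>
      have "word_map Q W ?u (p z) \<oslash>\<^bsub>Q\<^esub> word_map Q W ?v (p z) \<in> word_quotients Q \<W> A B"
        using W that u v by (rule word_quotientsI) (use pqB \<rho> in \<open>simp add: tuples_def Pi_iff\<close>)
      then have uv: "(word_map Q W ?u (p z), word_map Q W ?v (p z)) \<in> cong_of Q D"
        using quot u v pC[OF z] by (auto simp: cong_of_def Q.word_map_closed)
      have "(word_map Q W ?u (p z), word_map Q W ?v (q z)) \<in> cong_of Q D \<longleftrightarrow>
        (word_map Q W ?v (p z), word_map Q W ?v (q z)) \<in> cong_of Q D"
        using uv Q.congruence_sym[OF cD] Q.congruence_trans[OF cD] by blast
      also have "\<dots> \<longleftrightarrow> (p z, q z) \<in> cong_of Q D"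
        by (rule Q.congruence_word_map_iff[OF cD v pC[OF z] qC[OF z]])
      finally show ?thesis .
    qed
    then show ?thesis
      using inA z \<rho> loop_hom_word_map[OF P Q p \<rho> z] loop_hom_word_map[OF P Q q \<rho> z]
      by (auto simp: P.word_map_closed)
  qed
  show ?thesis
  proof (rule P.TInn_invariant_normal)
    have "(p z \<otimes>\<^bsub>Q\<^esub> p w, q z \<otimes>\<^bsub>Q\<^esub> q w) \<in> cong_of Q D \<and>
      (p z \<setminus>\<^bsub>Q\<^esub> p w, q z \<setminus>\<^bsub>Q\<^esub> q w) \<in> cong_of Q D \<and>
      (p z \<oslash>\<^bsub>Q\<^esub> p w, q z \<oslash>\<^bsub>Q\<^esub> q w) \<in> cong_of Q D" if "z \<in> ?S" "w \<in> ?S" for z w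
      using that Q.congruence_ops[OF cD] by auto
    then show "subloop ?S P"
      using p q A Q.congruence_refl[OF cD]
      by (auto simp: subloop_def normal_subloop_def loop_hom_def P.closed Q.closed)
    fix f z assume f: "f \<in> TInn P" and z: "z \<in> ?S"
    let ?H = "{word_map P W \<rho> | W \<rho>. W \<in> \<W> \<and> \<rho> \<in> tuples P}"
    have Bij: "generate (BijGroup (carrier P)) ?H \<subseteq> Bij (carrier P)"
      unfolding carrier_BijGroup[symmetric]
      by (intro group.generate_incl group_BijGroup) (auto simp: carrier_BijGroup P.word_map_Bij)
    from f[unfolded gen] z show "f z \<in> ?S"
    proof (induction arbitrary: z)
      case one
      then show ?case by (auto simp: BijGroup_def)
    next
      case (incl h)
      then show ?case using word_iff by blast
    next
      case (inv h)
      then obtain W \<rho> where h: "h = word_map P W \<rho>" "W \<in> \<W>" "\<rho> \<in> tuples P"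
        by blast
      have hB: "h \<in> Bij (carrier P)"
        using h P.word_map_Bij by simp
      have zP: "z \<in> carrier P"
        using inv by blast
      \<comment> \<open>The preimage of z: since \<open>h ?w = z\<close> lies in S,
        \<open>word_iff\<close> puts \<open>?w\<close> into S.\<close>
      let ?w = "inv_into (carrier P) h z"
      have "?w \<in> carrier P" "h ?w = z"
        using hB zP by (auto simp: Bij_inv_into_mem Bij_def bij_betw_def f_inv_into_f)
      then have "?w \<in> ?S"
        using word_iff[of W \<rho> ?w] h inv by simp
      then show ?case
        using zP hB by (simp add: inv_BijGroup)
    next
      case (eng f g)
      then have "f \<in> Bij (carrier P)" "g \<in> Bij (carrier P)" "z \<in> carrier P"
        using Bij by blast+
      then show ?case
        using eng by (simp only: BijGroup_mult_apply)
    qed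
  qed
qed

text \<open>The upper bound for the commutator. Generation of total inner mapping groups is applied
  to the loop P of pairs, which is why it is assumed for a whole variety.\<close>

lemma centralizes_cong_of:
  fixes V :: "'a::infinite loop set"
  assumes V: "loop_variety V" and gen: "generates_TInn V \<W>" and QV: "Q \<in> V"
    and A: "normal_subloop A Q" and B: "normal_subloop B Q"
    and D: "normal_subloop D Q" and quot: "word_quotients Q \<W> A B \<subseteq> D"
  shows "centralizes Q (cong_of Q A) (cong_of Q B) (cong_of Q D)"
proof -
  obtain E where E: "V = {Q. loop Q \<and> satisfies Q E}"
    using V by (auto simp: loop_variety_def)
  then interpret loop Q using QV by blast
  note cA = cong_of_congruence[OF A] and cB = cong_of_congruence[OF B]
    and cD = cong_of_congruence[OF D]
  obtain j :: "'a \<times> 'a \<Rightarrow> 'a" where j: "inj j"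
    using infinite_inj_pairs by blast
  define P where "P = pair_loop Q (cong_of Q B) j"
  define p where "p = (\<lambda>z. fst (inv_into UNIV j z))"
  define q where "q = (\<lambda>z. snd (inv_into UNIV j z))"
  note PL = pair_loop[OF cB j, folded P_def p_def q_def]
  have pj [simp]: "p (j z) = fst z" and qj [simp]: "q (j z) = snd z" for z
    using j by (simp_all add: p_def q_def)
  have carrierP: "carrier P = j ` cong_of Q B"
    by (simp add: P_def pair_loop_def Let_def)
  have PV: "P \<in> V"
    using PL QV by (auto simp: E)
  define S where "S = {z \<in> carrier P. p z \<in> A \<and> (p z, q z) \<in> cong_of Q D}"
  have "normal_subloop S P"
    unfolding S_def
  proof (rule normal_pairs[OF PL(1) loop_axioms PL(2,3) A D _ quot])
    show "p z \<oslash>\<^bsub>Q\<^esub> q z \<in> B" if "z \<in> carrier P" for z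
      using that by (auto simp: carrierP cong_of_def)
    show "word_map Q W \<rho> \<one>\<^bsub>Q\<^esub> = \<one>\<^bsub>Q\<^esub>" if "W \<in> \<W>" "\<rho> \<in> tuples Q" for W \<rho>
      using gen QV that by (auto simp: generates_TInn_def inner_word_def TInn_def)
    show "TInn P = generate (BijGroup (carrier P)) {word_map P W \<rho> | W \<rho>. W \<in> \<W> \<and> \<rho> \<in> tuples P}"
      using gen PV by (simp add: generates_TInn_def)
  qed
  then have cS: "congruence P (cong_of P S)"
    by (rule loop.cong_of_congruence[OF PL(1)])
  \<comment> \<open>Membership of z \<oslash> w in S, computed componentwise because p and q are
    homomorphisms.\<close>
  have S_iff: "(z, w) \<in> cong_of P S \<longleftrightarrow> z \<in> carrier P \<and> w \<in> carrier P \<and>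
      (p z, p w) \<in> cong_of Q A \<and> (p z \<oslash>\<^bsub>Q\<^esub> p w, q z \<oslash>\<^bsub>Q\<^esub> q w) \<in> cong_of Q D" for z w
    using PL(2,3) loop.rdiv_closed[OF PL(1)]
    by (auto simp: cong_of_def S_def loop_hom_def)
  show ?thesis
    unfolding centralizes_def
  proof (intro allI impI)
    fix t a b u v
    assume ab: "(a, b) \<in> cong_of Q A" and uv: "\<forall>i. (u i, v i) \<in> cong_of Q B"
      and eq: "(eval Q (case_nat a u) t, eval Q (case_nat a v) t) \<in> cong_of Q D"
    note abC = congruence_carrier[OF cA ab]
    have uvC: "u \<in> tuples Q" "v \<in> tuples Q"
      using uv by (auto simp: tuples_def cong_of_def)
    \<comment> \<open>Variable 0 carries the diagonal pair (x, x) and variable i + 1 the pair (u_i,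
      v_i), so the projections of this tuple are the two valuations in the term condition.\<close>
    define \<rho> where "\<rho> = (\<lambda>x. case_nat (j (x, x)) (\<lambda>i. j (u i, v i)))"
    have \<rho>: "\<rho> x \<in> tuples P" if "x \<in> carrier Q" for x
      using that uv congruence_refl[OF cB]
      by (auto simp: \<rho>_def tuples_def carrierP split: nat.split)
    have pq: "p \<circ> \<rho> x = case_nat x u" "q \<circ> \<rho> x = case_nat x v" for x
      by (auto simp: \<rho>_def split: nat.split)
    have ev: "p (eval P (\<rho> x) t) = eval Q (case_nat x u) t"
      "q (eval P (\<rho> x) t) = eval Q (case_nat x v) t" if "x \<in> carrier Q" for x
      using loop_hom_eval[OF PL(1,2) \<rho>[OF that]] loop_hom_eval[OF PL(1,3) \<rho>[OF that]]
      by (simp_all add: pq)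
    \<comment> \<open>The quotient of two diagonal pairs is diagonal, so its D-condition is
      reflexivity and only a \<oslash> b in A remains.\<close>
    have "(a \<oslash>\<^bsub>Q\<^esub> b, a \<oslash>\<^bsub>Q\<^esub> b) \<in> cong_of Q D"
      using abC by (simp add: congruence_refl cD closed)
    then have "(j (a, a), j (b, b)) \<in> cong_of P S"
      using abC ab congruence_refl[OF cB] by (simp add: S_iff carrierP)
    moreover have "(j (u i, v i), j (u i, v i)) \<in> cong_of P S" for i
      using uv by (intro loop.congruence_refl[OF PL(1) cS]) (simp add: carrierP)
    ultimately have "(\<rho> a i, \<rho> b i) \<in> cong_of P S" for i
      by (auto simp: \<rho>_def split: nat.split)
    then have "(eval P (\<rho> a) t, eval P (\<rho> b) t) \<in> cong_of P S"
      by (rule loop.congruence_eval[OF PL(1) cS])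
    then have "(eval Q (case_nat a u) t \<oslash>\<^bsub>Q\<^esub> eval Q (case_nat b u) t,
        eval Q (case_nat a v) t \<oslash>\<^bsub>Q\<^esub> eval Q (case_nat b v) t) \<in> cong_of Q D"
      using abC by (simp add: S_iff ev)
    \<comment> \<open>The quotients t(a,u) \<oslash> t(b,u) and t(a,v) \<oslash> t(b,v) agree modulo
      D, and so do their numerators by assumption; hence so do the denominators.\<close>
    from congruence_cancel_rdiv[OF cD this eq]
    show "(eval Q (case_nat b u) t, eval Q (case_nat b v) t) \<in> cong_of Q D"
      using abC(2) uvC by (simp add: eval_closed case_nat_tuples)
  qed
qed

theorem theorem2p2:
  fixes V :: "'a::infinite loop set" and \<W> :: "loop_word set"
    and Q :: "'a loop" and A B :: "'a set"
  assumes "loop_variety V"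
    and "generates_TInn V \<W>"
    and "Q \<in> V"
    and "normal_subloop A Q"
    and "normal_subloop B Q"
  shows "commutator Q A B =
    Ng Q {word_map Q W u a \<oslash>\<^bsub>Q\<^esub> word_map Q W v a | W a u v.
            W \<in> \<W> \<and> a \<in> A \<and> u \<in> tuples Q \<and> v \<in> tuples Q \<and> (\<forall>i. u i \<oslash>\<^bsub>Q\<^esub> v i \<in> B)}"
proof -
  interpret loop Q
    using assms(1,3) by (auto simp: loop_variety_def)
  let ?X = "word_quotients Q \<W> A B"
  define D where "D = Ng Q ?X"
  have "A \<subseteq> carrier Q"
    using assms(4) by (auto simp: normal_subloop_def subloop_def)
  then have "?X \<subseteq> carrier Q"
    by (auto simp: word_quotients_def word_map_closed rdiv_closed subset_iff)
  note Ng = Ng_least[OF this, folded D_def]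
  have fixed: "word_map Q W \<rho> \<one>\<^bsub>Q\<^esub> = \<one>\<^bsub>Q\<^esub>" if "W \<in> \<W>" "\<rho> \<in> tuples Q" for W \<rho>
    using assms(2,3) that by (auto simp: generates_TInn_def inner_word_def TInn_def)
  have "cong_commutator Q (cong_of Q A) (cong_of Q B) = cong_of Q D"
    unfolding cong_commutator_def
  proof (rule Least_equality)
    show "congruence Q (cong_of Q D) \<and> centralizes Q (cong_of Q A) (cong_of Q B) (cong_of Q D)"
      using cong_of_congruence[OF Ng(1)] centralizes_cong_of[OF assms Ng(1,2)] by blast
  next
    fix \<delta> assume \<delta>: "congruence Q \<delta> \<and> centralizes Q (cong_of Q A) (cong_of Q B) \<delta>"
    \<comment> \<open>The kernel is a normal subloop containing all word quotients, and D is the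
      least such.\<close>
    then have "D \<subseteq> kernel_of Q \<delta>"
      by (intro Ng(3) kernel_normal word_quotients_centralizer) (auto simp: loop_axioms assms fixed)
    then have "cong_of Q D \<subseteq> cong_of Q (kernel_of Q \<delta>)"
      by (auto simp: cong_of_def)
    then show "cong_of Q D \<le> \<delta>"
      using \<delta> by (simp add: cong_of_kernel)
  qed
  then have "commutator Q A B = D"
    using Ng(1) by (simp add: commutator_def kernel_of_cong normal_subloop_def subloop_def)
  then show ?thesis
    by (simp add: D_def word_quotients_def)
qed

end
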